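(* Let $\mathcal S$ be the class of Schreier split epimorphisms in $\mathbf{RPOGrp}$. The category $\mathbf{RPOGrp}$ is $\mathcal S$-protomodular; that is, $\mathcal S$ is stable under pullbacks, and for every morphism $(u,w,v)$ between two short $\mathcal S$-split exact sequences (a split epimorphism $A\rightleftarrows B$ in $\mathcal S$ with kernel $K$, and a split epimorphism $A'\rightleftarrows B'$ in $\mathcal S$ with kernel $K'$; $u:K\to K'$, $w:A\to A'$, $v:B\to B'$ morphisms of $\mathbf{RPOGrp}$ commuting with the kernel inclusions, the split epimorphisms and their sections), if $u$ and $v$ are isomorphisms then $w$ is an isomorphism.
   Context: Groups are written additively and need not be abelian. A right-preordered group is a pair $(G,P_G)$ with $G$ a group and $P_G$ a submonoid of $G$ (the positive cone). Morphisms $(G,P_G)\to(H,P_H)$ in $\mathbf{RPOGrp}$ are group homomorphisms $f$ with $f(P_G)\subseteq P_H$. Limits are computed separately on groups and on positive cones; in particular the kernel of $f$ is $(\ker f,\ker f\cap P_G)$. A split epimorphism $d:(X_1,P_1)\to(X_0,P_0)$ with section $e$ ($de=\mathrm{id}$) in $\mathbf{RPOGrp}$ is a Schreier split epimorphism if $a-e(d(a))\in P_1$ for all $a\in P_1$. *)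

theory Defs
  imports "HOL-Algebra.Coset"
begin

record 'a rpo = "'a monoid" +
  pos :: "'a set"

text \<open>
  Right-preordered groups. The paper writes groups additively, HOL-Algebra multiplicatively:
  \<open>a - b\<close> is \<open>a \<otimes>\<^bsub>G\<^esub> inv\<^bsub>G\<^esub> b\<close>. The groups need not be abelian.
\<close>

definition rpo_group :: "'a rpo \<Rightarrow> bool" where
  "rpo_group G \<longleftrightarrow> group G \<and> submonoid (pos G) G"

text \<open>
  A morphism is represented by a function on the whole type; two functions represent the same
  morphism iff they agree on the carrier of the domain, so equations between morphisms are always
  stated pointwise on carriers.
\<close>

definition rpo_hom :: "'a rpo \<Rightarrow> 'b rpo \<Rightarrow> ('a \<Rightarrow> 'b) set" where
  "rpo_hom G H = {f \<in> hom G H. f ` pos G \<subseteq> pos H}"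

definition rpo_iso :: "'a rpo \<Rightarrow> 'b rpo \<Rightarrow> ('a \<Rightarrow> 'b) set" where
  "rpo_iso G H = {f \<in> rpo_hom G H. \<exists>g \<in> rpo_hom H G.
     (\<forall>x\<in>carrier G. g (f x) = x) \<and> (\<forall>y\<in>carrier H. f (g y) = y)}"

definition split_epi :: "'a rpo \<Rightarrow> 'b rpo \<Rightarrow> ('a \<Rightarrow> 'b) \<Rightarrow> ('b \<Rightarrow> 'a) \<Rightarrow> bool" where
  "split_epi A B d e \<longleftrightarrow> rpo_group A \<and> rpo_group B \<and> d \<in> rpo_hom A B \<and> e \<in> rpo_hom B A \<and>
     (\<forall>b\<in>carrier B. d (e b) = b)"

definition schreier :: "'a rpo \<Rightarrow> 'b rpo \<Rightarrow> ('a \<Rightarrow> 'b) \<Rightarrow> ('b \<Rightarrow> 'a) \<Rightarrow> bool" where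
  "schreier A B d e \<longleftrightarrow> split_epi A B d e \<and>
     (\<forall>a\<in>pos A. a \<otimes>\<^bsub>A\<^esub> inv\<^bsub>A\<^esub> (e (d a)) \<in> pos A)"

text \<open>
  Kernels and pullbacks: first the concrete objects, computed on groups and on positive cones,
  then the general notion up to isomorphism. The universal properties are proved below, with test
  objects over an arbitrary type.
\<close>

definition kernel_obj :: "'a rpo \<Rightarrow> 'b rpo \<Rightarrow> ('a \<Rightarrow> 'b) \<Rightarrow> 'a rpo" where
  "kernel_obj A B d = A\<lparr>carrier := kernel A B d, pos := kernel A B d \<inter> pos A\<rparr>"

definition is_kernel ::
  "'k rpo \<Rightarrow> 'a rpo \<Rightarrow> 'b rpo \<Rightarrow> ('k \<Rightarrow> 'a) \<Rightarrow> ('a \<Rightarrow> 'b) \<Rightarrow> bool" where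
  "is_kernel K A B k d \<longleftrightarrow> rpo_group K \<and> rpo_group A \<and> rpo_group B \<and> d \<in> rpo_hom A B \<and>
     k \<in> rpo_iso K (kernel_obj A B d)"

definition pullback_obj ::
  "'y rpo \<Rightarrow> 'x rpo \<Rightarrow> ('y \<Rightarrow> 'b) \<Rightarrow> ('x \<Rightarrow> 'b) \<Rightarrow> ('y \<times> 'x) rpo" where
  "pullback_obj Y X f d =
    \<lparr>carrier = {(y, x). y \<in> carrier Y \<and> x \<in> carrier X \<and> f y = d x},
     monoid.mult = monoid.mult (Y \<times>\<times> X), one = one (Y \<times>\<times> X),
     pos = {(y, x). y \<in> pos Y \<and> x \<in> pos X \<and> f y = d x}\<rparr>"

text \<open>
  \<open>is_pullback Z Y X B p q f d\<close>: the maps \<open>p : Z \<rightarrow> Y\<close> and \<open>q : Z \<rightarrow> X\<close> form a pullback of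
  \<open>f : Y \<rightarrow> B\<close> and \<open>d : X \<rightarrow> B\<close>.
\<close>

definition is_pullback ::
  "'z rpo \<Rightarrow> 'y rpo \<Rightarrow> 'x rpo \<Rightarrow> 'b rpo \<Rightarrow> ('z \<Rightarrow> 'y) \<Rightarrow> ('z \<Rightarrow> 'x) \<Rightarrow> ('y \<Rightarrow> 'b) \<Rightarrow> ('x \<Rightarrow> 'b) \<Rightarrow> bool"
  where
  "is_pullback Z Y X B p q f d \<longleftrightarrow>
     rpo_group Z \<and> rpo_group Y \<and> rpo_group X \<and> rpo_group B \<and>
     f \<in> rpo_hom Y B \<and> d \<in> rpo_hom X B \<and>
     (\<lambda>z. (p z, q z)) \<in> rpo_iso Z (pullback_obj Y X f d)"

definition schreier_split_exact ::
  "'k rpo \<Rightarrow> 'a rpo \<Rightarrow> 'b rpo \<Rightarrow> ('k \<Rightarrow> 'a) \<Rightarrow> ('a \<Rightarrow> 'b) \<Rightarrow> ('b \<Rightarrow> 'a) \<Rightarrow> bool" where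
  "schreier_split_exact K A B k d e \<longleftrightarrow> schreier A B d e \<and> is_kernel K A B k d"

text \<open>
  A morphism \<open>(u, w, v)\<close> of short split exact sequences; the primed sequence is the codomain.
\<close>

definition seq_hom ::
  "'k rpo \<Rightarrow> 'a rpo \<Rightarrow> 'b rpo \<Rightarrow> ('k \<Rightarrow> 'a) \<Rightarrow> ('a \<Rightarrow> 'b) \<Rightarrow> ('b \<Rightarrow> 'a) \<Rightarrow>
   'k1 rpo \<Rightarrow> 'a1 rpo \<Rightarrow> 'b1 rpo \<Rightarrow> ('k1 \<Rightarrow> 'a1) \<Rightarrow> ('a1 \<Rightarrow> 'b1) \<Rightarrow> ('b1 \<Rightarrow> 'a1) \<Rightarrow>
   ('k \<Rightarrow> 'k1) \<Rightarrow> ('a \<Rightarrow> 'a1) \<Rightarrow> ('b \<Rightarrow> 'b1) \<Rightarrow> bool" where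
  "seq_hom K A B k d e K' A' B' k' d' e' u w v \<longleftrightarrow>
     u \<in> rpo_hom K K' \<and> w \<in> rpo_hom A A' \<and> v \<in> rpo_hom B B' \<and>
     (\<forall>x\<in>carrier K. w (k x) = k' (u x)) \<and>
     (\<forall>a\<in>carrier A. d' (w a) = v (d a)) \<and>
     (\<forall>b\<in>carrier B. w (e b) = e' (v b))"

subsection \<open>Universal properties of kernels and pullbacks\<close>

lemma rpo_hom_hom: "f \<in> rpo_hom G H \<Longrightarrow> f \<in> hom G H"
  by (simp add: rpo_hom_def)

lemma rpo_hom_pos: "f \<in> rpo_hom G H \<Longrightarrow> x \<in> pos G \<Longrightarrow> f x \<in> pos H"
  by (auto simp: rpo_hom_def)

lemma rpo_hom_carrier: "f \<in> rpo_hom G H \<Longrightarrow> x \<in> carrier G \<Longrightarrow> f x \<in> carrier H"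
  by (auto simp: rpo_hom_def hom_def)

lemma rpo_hom_mult:
  "f \<in> rpo_hom G H \<Longrightarrow> x \<in> carrier G \<Longrightarrow> y \<in> carrier G \<Longrightarrow> f (x \<otimes>\<^bsub>G\<^esub> y) = f x \<otimes>\<^bsub>H\<^esub> f y"
  by (auto simp: rpo_hom_def hom_def)

lemma rpo_hom_compose:
  assumes "f \<in> rpo_hom G H" "g \<in> rpo_hom H I"
  shows "(\<lambda>x. g (f x)) \<in> rpo_hom G I"
  using assms by (auto simp: rpo_hom_def hom_def Pi_def image_subset_iff)

lemma rpo_group_kernel_obj:
  assumes A: "rpo_group A" and B: "rpo_group B" and d: "d \<in> rpo_hom A B"
  shows "rpo_group (kernel_obj A B d)"
proof -
  interpret group_hom A B d
    using A B rpo_hom_hom[OF d]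
    by (auto simp: rpo_group_def group_hom_def group_hom_axioms_def)
  interpret P: submonoid "pos A" A using A by (simp add: rpo_group_def)
  have "group (kernel_obj A B d)"
  proof (rule groupI)
    fix x assume "x \<in> carrier (kernel_obj A B d)"
    then show "\<exists>y\<in>carrier (kernel_obj A B d).
        y \<otimes>\<^bsub>kernel_obj A B d\<^esub> x = \<one>\<^bsub>kernel_obj A B d\<^esub>"
      by (intro bexI[of _ "inv\<^bsub>A\<^esub> x"]) (auto simp: kernel_obj_def kernel_def)
  qed (auto simp: kernel_obj_def kernel_def G.m_assoc)
  moreover have "submonoid (kernel A B d \<inter> pos A) (kernel_obj A B d)"
    by (auto simp: submonoid_def kernel_obj_def kernel_def P.one_closed P.m_closed)
  ultimately show ?thesis by (simp add: rpo_group_def kernel_obj_def)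
qed

lemma is_kernel_kernel_obj:
  assumes "rpo_group A" "rpo_group B" "d \<in> rpo_hom A B"
  shows "is_kernel (kernel_obj A B d) A B (\<lambda>x. x) d"
  using assms rpo_group_kernel_obj[OF assms]
  by (auto simp: is_kernel_def rpo_iso_def rpo_hom_def hom_def)

lemma is_kernel_universal:
  assumes ker: "is_kernel K A B k d"
  shows "k \<in> rpo_hom K A"
    and "x \<in> carrier K \<Longrightarrow> d (k x) = \<one>\<^bsub>B\<^esub>"
    and "\<lbrakk>rpo_group T; t \<in> rpo_hom T A; \<And>x. x \<in> carrier T \<Longrightarrow> d (t x) = \<one>\<^bsub>B\<^esub>\<rbrakk> \<Longrightarrow>
      \<exists>h \<in> rpo_hom T K. (\<forall>x\<in>carrier T. k (h x) = t x) \<and>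
        (\<forall>h' \<in> rpo_hom T K. (\<forall>x\<in>carrier T. k (h' x) = t x) \<longrightarrow> (\<forall>x\<in>carrier T. h' x = h x))"
proof -
  have k: "k \<in> rpo_hom K (kernel_obj A B d)" using ker by (simp add: is_kernel_def rpo_iso_def)
  then show "k \<in> rpo_hom K A"
    by (auto simp: rpo_hom_def hom_def kernel_obj_def kernel_def Pi_def)
  show "x \<in> carrier K \<Longrightarrow> d (k x) = \<one>\<^bsub>B\<^esub>"
    using rpo_hom_carrier[OF k] by (auto simp: kernel_obj_def kernel_def)
  obtain g where g: "g \<in> rpo_hom (kernel_obj A B d) K" "\<forall>x\<in>carrier K. g (k x) = x"
    "\<forall>y\<in>carrier (kernel_obj A B d). k (g y) = y"
    using ker by (auto simp: is_kernel_def rpo_iso_def)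
  assume T: "rpo_group T" and t: "t \<in> rpo_hom T A"
    and t1: "\<And>x. x \<in> carrier T \<Longrightarrow> d (t x) = \<one>\<^bsub>B\<^esub>"
  have "pos T \<subseteq> carrier T" using T by (simp add: rpo_group_def submonoid_def)
  then have tk: "t \<in> rpo_hom T (kernel_obj A B d)"
    using t t1 by (auto simp: rpo_hom_def hom_def kernel_obj_def kernel_def Pi_def image_subset_iff)
  show "\<exists>h \<in> rpo_hom T K. (\<forall>x\<in>carrier T. k (h x) = t x) \<and>
        (\<forall>h' \<in> rpo_hom T K. (\<forall>x\<in>carrier T. k (h' x) = t x) \<longrightarrow> (\<forall>x\<in>carrier T. h' x = h x))"
  proof (intro bexI[of _ "\<lambda>x. g (t x)"] conjI ballI impI)
    fix x assume "x \<in> carrier T"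
    then show "k (g (t x)) = t x" using g(3) rpo_hom_carrier[OF tk] by blast
  next
    fix h' x assume "h' \<in> rpo_hom T K" "\<forall>x\<in>carrier T. k (h' x) = t x" "x \<in> carrier T"
    then show "h' x = g (t x)" using g(2) rpo_hom_carrier by metis
  qed (rule rpo_hom_compose[OF tk g(1)])
qed

lemma rpo_group_pullback_obj:
  assumes Y: "rpo_group Y" and X: "rpo_group X" and B: "rpo_group B"
    and f: "f \<in> rpo_hom Y B" and d: "d \<in> rpo_hom X B"
  shows "rpo_group (pullback_obj Y X f d)"
proof -
  interpret f: group_hom Y B f
    using Y B rpo_hom_hom[OF f]
    by (auto simp: rpo_group_def group_hom_def group_hom_axioms_def)
  interpret d: group_hom X B d
    using X B rpo_hom_hom[OF d]
    by (auto simp: rpo_group_def group_hom_def group_hom_axioms_def)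
  interpret PY: submonoid "pos Y" Y using Y by (simp add: rpo_group_def)
  interpret PX: submonoid "pos X" X using X by (simp add: rpo_group_def)
  have "group (pullback_obj Y X f d)"
  proof (rule groupI)
    fix z assume "z \<in> carrier (pullback_obj Y X f d)"
    then obtain y x where z: "z = (y, x)" "y \<in> carrier Y" "x \<in> carrier X" "f y = d x"
      by (auto simp: pullback_obj_def)
    then show "\<exists>w\<in>carrier (pullback_obj Y X f d).
        w \<otimes>\<^bsub>pullback_obj Y X f d\<^esub> z = \<one>\<^bsub>pullback_obj Y X f d\<^esub>"
      by (intro bexI[of _ "(inv\<^bsub>Y\<^esub> y, inv\<^bsub>X\<^esub> x)"]) (auto simp: pullback_obj_def)
  qed (auto simp: pullback_obj_def f.G.m_assoc d.G.m_assoc)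
  moreover have "submonoid (pos (pullback_obj Y X f d)) (pullback_obj Y X f d)"
    using PY.subset PX.subset
    by (auto simp: submonoid_def pullback_obj_def subset_iff)
  ultimately show ?thesis by (simp add: rpo_group_def)
qed

lemma is_pullback_pullback_obj:
  assumes "rpo_group Y" "rpo_group X" "rpo_group B" "f \<in> rpo_hom Y B" "d \<in> rpo_hom X B"
  shows "is_pullback (pullback_obj Y X f d) Y X B fst snd f d"
proof -
  have "(\<lambda>z. z) \<in> rpo_iso (pullback_obj Y X f d) (pullback_obj Y X f d)"
    by (auto simp: rpo_iso_def rpo_hom_def hom_def)
  then show ?thesis using assms rpo_group_pullback_obj[OF assms] by (simp add: is_pullback_def)
qed

lemma is_pullback_universal:
  assumes pb: "is_pullback Z Y X B p q f d"
  shows "p \<in> rpo_hom Z Y" and "q \<in> rpo_hom Z X"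
    and "z \<in> carrier Z \<Longrightarrow> f (p z) = d (q z)"
    and "\<lbrakk>rpo_group T; a \<in> rpo_hom T Y; b \<in> rpo_hom T X;
        \<And>t. t \<in> carrier T \<Longrightarrow> f (a t) = d (b t)\<rbrakk> \<Longrightarrow>
      \<exists>h \<in> rpo_hom T Z. (\<forall>t\<in>carrier T. p (h t) = a t \<and> q (h t) = b t) \<and>
        (\<forall>h' \<in> rpo_hom T Z. (\<forall>t\<in>carrier T. p (h' t) = a t \<and> q (h' t) = b t) \<longrightarrow>
          (\<forall>t\<in>carrier T. h' t = h t))"
proof -
  let ?P = "pullback_obj Y X f d" and ?c = "\<lambda>z. (p z, q z)"
  have c: "?c \<in> rpo_hom Z ?P" using pb by (simp add: is_pullback_def rpo_iso_def)
  then show "p \<in> rpo_hom Z Y" "q \<in> rpo_hom Z X"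
    by (auto simp: rpo_hom_def hom_def pullback_obj_def Pi_def image_subset_iff)
  show "z \<in> carrier Z \<Longrightarrow> f (p z) = d (q z)"
    using rpo_hom_carrier[OF c] by (auto simp: pullback_obj_def)
  obtain g where g: "g \<in> rpo_hom ?P Z" "\<forall>z\<in>carrier Z. g (?c z) = z"
    "\<forall>y\<in>carrier ?P. ?c (g y) = y"
    using pb unfolding is_pullback_def rpo_iso_def by blast
  assume T: "rpo_group T" and a: "a \<in> rpo_hom T Y" and b: "b \<in> rpo_hom T X"
    and eq: "\<And>t. t \<in> carrier T \<Longrightarrow> f (a t) = d (b t)"
  have "pos T \<subseteq> carrier T" using T by (simp add: rpo_group_def submonoid_def)
  then have ab: "(\<lambda>t. (a t, b t)) \<in> rpo_hom T ?P"
    using a b eq by (auto simp: rpo_hom_def hom_def pullback_obj_def Pi_def image_subset_iff)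
  show "\<exists>h \<in> rpo_hom T Z. (\<forall>t\<in>carrier T. p (h t) = a t \<and> q (h t) = b t) \<and>
        (\<forall>h' \<in> rpo_hom T Z. (\<forall>t\<in>carrier T. p (h' t) = a t \<and> q (h' t) = b t) \<longrightarrow>
          (\<forall>t\<in>carrier T. h' t = h t))"
  proof (intro bexI[of _ "\<lambda>t. g (a t, b t)"] conjI ballI impI)
    fix t assume "t \<in> carrier T"
    then have "?c (g (a t, b t)) = (a t, b t)" using g(3) rpo_hom_carrier[OF ab] by blast
    then show "p (g (a t, b t)) = a t" "q (g (a t, b t)) = b t" by auto
  next
    fix h' t assume h': "h' \<in> rpo_hom T Z"
      "\<forall>t\<in>carrier T. p (h' t) = a t \<and> q (h' t) = b t" "t \<in> carrier T"
    then have "g (?c (h' t)) = h' t" using g(2) rpo_hom_carrier by fast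
    then show "h' t = g (a t, b t)" using h' by simp
  qed (rule rpo_hom_compose[OF ab g(1)])
qed

lemma pullback_section:
  assumes pb: "is_pullback Z Y X B p q f d" and de: "split_epi X B d e"
  shows "\<exists>s \<in> rpo_hom Y Z. (\<forall>y\<in>carrier Y. p (s y) = y \<and> q (s y) = e (f y))"
proof -
  have Y: "rpo_group Y" and f: "f \<in> rpo_hom Y B" using pb by (auto simp: is_pullback_def)
  have e: "e \<in> rpo_hom B X" and "\<forall>b\<in>carrier B. d (e b) = b" using de by (auto simp: split_epi_def)
  then have "f y = d (e (f y))" if "y \<in> carrier Y" for y using rpo_hom_carrier[OF f that] by simp
  moreover have "(\<lambda>y. y) \<in> rpo_hom Y Y" by (auto simp: rpo_hom_def hom_def)
  ultimately show ?thesis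
    using is_pullback_universal(4)[OF pb Y _ rpo_hom_compose[OF f e], of "\<lambda>y. y"] by blast
qed

end

(*
  In a Schreier split epimorphism every element is a = (a - e (d a)) + e (d a), a kernel element
  plus an element of the section, and both summands are positive when a is. A morphism of split
  exact sequences respects these decompositions, so if it is bijective on kernels and on quotients,
  both for carriers and for positive cones, then it is so in the middle.
*)
theory Submission
  imports Defs
begin

lemma rpo_group_pos_carrier: "rpo_group G \<Longrightarrow> x \<in> pos G \<Longrightarrow> x \<in> carrier G"
  by (auto simp: rpo_group_def submonoid_def)

lemma rpo_hom_group_hom:
  "rpo_group G \<Longrightarrow> rpo_group H \<Longrightarrow> f \<in> rpo_hom G H \<Longrightarrow> group_hom G H f"
  by (simp add: rpo_group_def rpo_hom_def group_hom_def group_hom_axioms_def)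

lemma rpo_hom_mult_inv:
  assumes "rpo_group G" "rpo_group H" "f \<in> rpo_hom G H" "x \<in> carrier G" "y \<in> carrier G"
  shows "f (x \<otimes>\<^bsub>G\<^esub> inv\<^bsub>G\<^esub> y) = f x \<otimes>\<^bsub>H\<^esub> inv\<^bsub>H\<^esub> (f y)"
proof -
  interpret group_hom G H f using assms by (intro rpo_hom_group_hom)
  show ?thesis using assms by simp
qed

text \<open>The inverse morphism supplies all the preimages. It preserves positive cones, so a
  positive \<open>y\<close> has a positive preimage; that \<open>H\<close> is an
  \<open>rpo_group\<close> puts \<open>y\<close> in the carrier, where the inverse law is
  available.\<close>

lemma rpo_isoD:
  assumes "f \<in> rpo_iso G H"
  shows "inj_on f (carrier G)"
    and "y \<in> carrier H \<Longrightarrow> \<exists>x\<in>carrier G. f x = y"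
    and "rpo_group H \<Longrightarrow> y \<in> pos H \<Longrightarrow> \<exists>x\<in>pos G. f x = y"
proof -
  obtain g where g: "g \<in> rpo_hom H G" "\<forall>x\<in>carrier G. g (f x) = x" "\<forall>y\<in>carrier H. f (g y) = y"
    using assms by (auto simp: rpo_iso_def)
  show "inj_on f (carrier G)" using g(2) by (metis inj_onI)
  show "y \<in> carrier H \<Longrightarrow> \<exists>x\<in>carrier G. f x = y" using g rpo_hom_carrier by metis
  show "rpo_group H \<Longrightarrow> y \<in> pos H \<Longrightarrow> \<exists>x\<in>pos G. f x = y"
    using g rpo_hom_pos rpo_group_pos_carrier by metis
qed

text \<open>A bijective morphism may have an inverse that does not preserve positive cones, so
  surjectivity is asked separately of carriers and of cones.\<close>

lemma rpo_isoI:
  assumes G: "rpo_group G" and f: "f \<in> rpo_hom G H" and inj: "inj_on f (carrier G)"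
    and surj: "\<And>y. y \<in> carrier H \<Longrightarrow> \<exists>x\<in>carrier G. f x = y"
    and surj_pos: "\<And>y. y \<in> pos H \<Longrightarrow> \<exists>x\<in>pos G. f x = y"
  shows "f \<in> rpo_iso G H"
proof -
  interpret group G using G by (simp add: rpo_group_def)
  let ?g = "inv_into (carrier G) f"
  have im: "f ` carrier G = carrier H"
    using surj rpo_hom_carrier[OF f] by blast
  have gf: "?g (f x) = x" if "x \<in> carrier G" for x using inj that by simp
  have gc: "?g y \<in> carrier G" and fg: "f (?g y) = y" if "y \<in> carrier H" for y
    using that im by (auto intro: inv_into_into f_inv_into_f)
  have "?g (y \<otimes>\<^bsub>H\<^esub> z) = ?g y \<otimes>\<^bsub>G\<^esub> ?g z" if "y \<in> carrier H" "z \<in> carrier H" for y z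
    using gf[of "?g y \<otimes>\<^bsub>G\<^esub> ?g z"] rpo_hom_mult[OF f gc gc] that gc fg by simp
  \<comment> \<open>By injectivity the preimage chosen by \<open>inv_into\<close> is the positive
    one that \<open>surj_pos\<close> supplies.\<close>
  moreover have "?g y \<in> pos G" if "y \<in> pos H" for y
    using surj_pos[OF that] gf rpo_group_pos_carrier[OF G] by metis
  ultimately have "?g \<in> rpo_hom H G" using gc by (auto simp: rpo_hom_def hom_def)
  then show ?thesis using f gf fg by (auto simp: rpo_iso_def)
qed

text \<open>\<open>K\<close> is only isomorphic to the concrete kernel, whose cone is the kernel
  intersected with \<open>pos A\<close>; both lifts transport elements back along this
  isomorphism.\<close>

lemma is_kernel_lift:
  assumes ker: "is_kernel K A B k d" and a: "a \<in> carrier A" "d a = \<one>\<^bsub>B\<^esub>"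
  shows "\<exists>x\<in>carrier K. k x = a" and "a \<in> pos A \<Longrightarrow> \<exists>x\<in>pos K. k x = a"
proof -
  have iso: "k \<in> rpo_iso K (kernel_obj A B d)" and grp: "rpo_group (kernel_obj A B d)"
    using ker rpo_group_kernel_obj by (auto simp: is_kernel_def)
  show "\<exists>x\<in>carrier K. k x = a" "a \<in> pos A \<Longrightarrow> \<exists>x\<in>pos K. k x = a"
    using rpo_isoD(2)[OF iso, of a] rpo_isoD(3)[OF iso grp, of a] a
    by (auto simp: kernel_obj_def kernel_def)
qed

text \<open>Since \<open>d (e (d a)) = d a\<close>, the map \<open>d\<close> sends the first factor
  to \<open>d a\<close> times its own inverse. Positivity is left aside here; the Schreier condition
  adds it.\<close>

lemma split_epi_decomp:
  assumes "split_epi A B d e" and a: "a \<in> carrier A"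
  shows "a \<otimes>\<^bsub>A\<^esub> inv\<^bsub>A\<^esub> (e (d a)) \<in> carrier A"
    and "d (a \<otimes>\<^bsub>A\<^esub> inv\<^bsub>A\<^esub> (e (d a))) = \<one>\<^bsub>B\<^esub>"
    and "(a \<otimes>\<^bsub>A\<^esub> inv\<^bsub>A\<^esub> (e (d a))) \<otimes>\<^bsub>A\<^esub> e (d a) = a"
proof -
  have A: "rpo_group A" and B: "rpo_group B" and d: "d \<in> rpo_hom A B" and e: "e \<in> rpo_hom B A"
    and de: "\<forall>b\<in>carrier B. d (e b) = b"
    using assms by (auto simp: split_epi_def)
  interpret group_hom A B d by (rule rpo_hom_group_hom[OF A B d])
  have c: "e (d a) \<in> carrier A" using a rpo_hom_carrier[OF e] by simp
  show "a \<otimes>\<^bsub>A\<^esub> inv\<^bsub>A\<^esub> (e (d a)) \<in> carrier A"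
    and "d (a \<otimes>\<^bsub>A\<^esub> inv\<^bsub>A\<^esub> (e (d a))) = \<one>\<^bsub>B\<^esub>"
    and "(a \<otimes>\<^bsub>A\<^esub> inv\<^bsub>A\<^esub> (e (d a))) \<otimes>\<^bsub>A\<^esub> e (d a) = a"
    using a c de by (simp_all add: G.m_assoc)
qed

text \<open>Positivity in a pullback is tested by the two projections. On the element in question
  \<open>p\<close> gives the unit of \<open>Y\<close>, and \<open>q\<close> gives the corresponding
  difference for \<open>q z\<close> in \<open>X\<close>, which the Schreier condition makes
  positive.\<close>

lemma schreier_pullback:
  assumes sch: "schreier X B d e" and pb: "is_pullback Z Y X B p q f d"
    and s: "s \<in> rpo_hom Y Z" and s_eq: "\<forall>y\<in>carrier Y. p (s y) = y \<and> q (s y) = e (f y)"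
  shows "schreier Z Y p s"
proof -
  have Z: "rpo_group Z" and Y: "rpo_group Y" and X: "rpo_group X"
    using pb by (auto simp: is_pullback_def)
  note p = is_pullback_universal(1)[OF pb] and q = is_pullback_universal(2)[OF pb]
    and fpdq = is_pullback_universal(3)[OF pb]
  have iso: "(\<lambda>z. (p z, q z)) \<in> rpo_iso Z (pullback_obj Y X f d)"
    and P: "rpo_group (pullback_obj Y X f d)"
    using pb rpo_group_pullback_obj by (auto simp: is_pullback_def)
  have se: "split_epi Z Y p s" using Z Y p s s_eq by (simp add: split_epi_def)
  have "z \<otimes>\<^bsub>Z\<^esub> inv\<^bsub>Z\<^esub> (s (p z)) \<in> pos Z" (is "?z \<in> _") if zp: "z \<in> pos Z" for z
  proof -
    have z: "z \<in> carrier Z" and pz: "p z \<in> carrier Y" and sz: "s (p z) \<in> carrier Z"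
      using rpo_group_pos_carrier[OF Z zp] rpo_hom_carrier p s by metis+
    have zc: "?z \<in> carrier Z" and p1: "p ?z = \<one>\<^bsub>Y\<^esub>"
      using split_epi_decomp[OF se z] by auto
    have "\<one>\<^bsub>Y\<^esub> \<in> pos Y" using Y by (simp add: rpo_group_def submonoid_def)
    \<comment> \<open>Here \<open>q (s (p z)) = e (f (p z))\<close>, and the pullback square turns
      \<open>f (p z)\<close> into \<open>d (q z)\<close>.\<close>
    moreover have "q ?z = q z \<otimes>\<^bsub>X\<^esub> inv\<^bsub>X\<^esub> (e (d (q z)))"
      using rpo_hom_mult_inv[OF Z X q z sz] s_eq pz fpdq[OF z] by simp
    then have "q ?z \<in> pos X" using sch rpo_hom_pos[OF q zp] by (simp add: schreier_def)
    ultimately have "(p ?z, q ?z) \<in> pos (pullback_obj Y X f d)"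
      using p1 fpdq[OF zc] by (simp add: pullback_obj_def)
    \<comment> \<open>The pair is positive in the concrete pullback. To return to \<open>Z\<close>,
      take a positive preimage and identify it with \<open>?z\<close> by injectivity.\<close>
    then obtain z0 where z0: "z0 \<in> pos Z" "(p z0, q z0) = (p ?z, q ?z)"
      using rpo_isoD(3)[OF iso P] by blast
    have "z0 = ?z"
      using inj_onD[OF rpo_isoD(1)[OF iso] z0(2)] zc rpo_group_pos_carrier[OF Z z0(1)] by simp
    then show ?thesis using z0 by simp
  qed
  then show ?thesis using se by (simp add: schreier_def)
qed

text \<open>On carriers this is the split short five lemma for groups. The Schreier condition on the
  primed sequence gives surjectivity on positive cones, which makes the inverse of \<open>w\<close>
  a morphism.\<close>

lemma schreier_short_five:
  assumes E: "schreier_split_exact K A B k d e" and E': "schreier_split_exact K' A' B' k' d' e'"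
    and uwv: "seq_hom K A B k d e K' A' B' k' d' e' u w v"
    and u: "u \<in> rpo_iso K K'" and v: "v \<in> rpo_iso B B'"
  shows "w \<in> rpo_iso A A'"
proof -
  have ker: "is_kernel K A B k d" and ker': "is_kernel K' A' B' k' d'"
    and sch: "schreier A' B' d' e'" and se': "split_epi A' B' d' e'"
    using E E' by (auto simp: schreier_split_exact_def schreier_def)
  have grps: "rpo_group K" "rpo_group A" "rpo_group B" "rpo_group K'" "rpo_group A'" "rpo_group B'"
    and d: "d \<in> rpo_hom A B" and d': "d' \<in> rpo_hom A' B'"
    using ker ker' by (auto simp: is_kernel_def)
  have e: "e \<in> rpo_hom B A" using E by (simp add: schreier_split_exact_def schreier_def split_epi_def)
  have uh: "u \<in> rpo_hom K K'" and w: "w \<in> rpo_hom A A'" and vh: "v \<in> rpo_hom B B'"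
    and wk: "\<And>x. x \<in> carrier K \<Longrightarrow> w (k x) = k' (u x)"
    and dw: "\<And>a. a \<in> carrier A \<Longrightarrow> d' (w a) = v (d a)"
    and we: "\<And>b. b \<in> carrier B \<Longrightarrow> w (e b) = e' (v b)"
    using uwv by (auto simp: seq_hom_def)
  note k = is_kernel_universal(1)[OF ker] and k' = is_kernel_universal(1)[OF ker']
  interpret A: submonoid "pos A" A using grps by (simp add: rpo_group_def)
  interpret k: group_hom K A k by (rule rpo_hom_group_hom[OF grps(1,2) k])
  interpret d': group_hom A' B' d' by (rule rpo_hom_group_hom[OF grps(5,6) d'])
  interpret k': group_hom K' A' k' by (rule rpo_hom_group_hom[OF grps(4,5) k'])
  interpret u: group_hom K K' u by (rule rpo_hom_group_hom[OF grps(1,4) uh])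
  interpret v: group_hom B B' v by (rule rpo_hom_group_hom[OF grps(3,6) vh])
  interpret w: group_hom A A' w by (rule rpo_hom_group_hom[OF grps(2,5) w])
  have k'_inj: "inj_on k' (carrier K')" using ker' rpo_isoD(1) by (auto simp: is_kernel_def)
  \<comment> \<open>Triviality of the kernel of \<open>w\<close>: injectivity of \<open>v\<close>
    forces \<open>a\<close> to come from \<open>K\<close>, where \<open>k'\<close> and
    \<open>u\<close> are both injective.\<close>
  have "a = \<one>\<^bsub>A\<^esub>" if a: "a \<in> carrier A" "w a = \<one>\<^bsub>A'\<^esub>" for a
  proof -
    have "v (d a) = v \<one>\<^bsub>B\<^esub>" using dw[OF a(1)] a by simp
    then have "d a = \<one>\<^bsub>B\<^esub>"
      using inj_onD[OF rpo_isoD(1)[OF v], of "d a" "\<one>\<^bsub>B\<^esub>"] rpo_hom_carrier[OF d a(1)] by simp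
    then obtain x where x: "x \<in> carrier K" "k x = a" using is_kernel_lift(1)[OF ker a(1)] by blast
    then have "k' (u x) = k' (u \<one>\<^bsub>K\<^esub>)" using wk[OF x(1)] a by simp
    then have "u x = u \<one>\<^bsub>K\<^esub>" using inj_onD[OF k'_inj, of "u x" "u \<one>\<^bsub>K\<^esub>"] x by simp
    then have "x = \<one>\<^bsub>K\<^esub>" using inj_onD[OF rpo_isoD(1)[OF u], of x "\<one>\<^bsub>K\<^esub>"] x by simp
    then show ?thesis using x by simp
  qed
  then have inj: "inj_on w (carrier A)" by (simp add: w.inj_on_one_iff)
  \<comment> \<open>Shared by both surjectivity arguments: \<open>w\<close> sends the product to
    \<open>k' (u x)\<close> times \<open>e' (v b)\<close>, which is the decomposition of
    \<open>a\<close>.\<close>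
  have lift: "w (k x \<otimes>\<^bsub>A\<^esub> e b) = a"
    if "a \<in> carrier A'" "x \<in> carrier K" "k' (u x) = a \<otimes>\<^bsub>A'\<^esub> inv\<^bsub>A'\<^esub> (e' (d' a))"
      "b \<in> carrier B" "v b = d' a" for a x b
    using that split_epi_decomp(3)[OF se'] wk we rpo_hom_carrier[OF e] by simp
  show ?thesis
  proof (rule rpo_isoI[OF grps(2) w inj])
    fix a assume a: "a \<in> carrier A'"
    obtain x' where x': "x' \<in> carrier K'" "k' x' = a \<otimes>\<^bsub>A'\<^esub> inv\<^bsub>A'\<^esub> (e' (d' a))"
      using is_kernel_lift(1)[OF ker' split_epi_decomp(1,2)[OF se' a]] by blast
    obtain x b where "x \<in> carrier K" "u x = x'" "b \<in> carrier B" "v b = d' a"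
      using rpo_isoD(2)[OF u x'(1)] rpo_isoD(2)[OF v rpo_hom_carrier[OF d' a]] by blast
    then show "\<exists>c\<in>carrier A. w c = a"
      using lift[OF a] x' rpo_hom_carrier[OF e]
      by (intro bexI[of _ "k x \<otimes>\<^bsub>A\<^esub> e b"]) auto
  next
    fix a assume ap: "a \<in> pos A'"
    then have a: "a \<in> carrier A'" by (rule rpo_group_pos_carrier[OF grps(5)])
    \<comment> \<open>The Schreier condition makes the kernel factor of \<open>a\<close> positive,
      so it lifts into the cone of \<open>K'\<close>, not merely its carrier.\<close>
    obtain x' where x': "x' \<in> pos K'" "k' x' = a \<otimes>\<^bsub>A'\<^esub> inv\<^bsub>A'\<^esub> (e' (d' a))"
      using is_kernel_lift(2)[OF ker' split_epi_decomp(1,2)[OF se' a]] sch ap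
      by (auto simp: schreier_def)
    obtain x b where xb: "x \<in> pos K" "u x = x'" "b \<in> pos B" "v b = d' a"
      using rpo_isoD(3)[OF u grps(4) x'(1)] rpo_isoD(3)[OF v grps(6) rpo_hom_pos[OF d' ap]] by blast
    then have "k x \<otimes>\<^bsub>A\<^esub> e b \<in> pos A"
      using rpo_hom_pos[OF k] rpo_hom_pos[OF e] by (intro A.m_closed) auto
    moreover have "w (k x \<otimes>\<^bsub>A\<^esub> e b) = a"
      using lift[OF a, of x b] xb x' rpo_group_pos_carrier[OF grps(1)]
        rpo_group_pos_carrier[OF grps(3)] by simp
    ultimately show "\<exists>c\<in>pos A. w c = a" by blast
  qed
qed

text \<open>Stability is stated for every pullback up to isomorphism. The section \<open>s\<close>
  is fixed by its two projections; its existence is \<open>pullback_section\<close>.\<close>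

theorem mainTheorem10:
  shows "(\<forall>(X :: 'x rpo) (X0 :: 'x0 rpo) (Y :: 'y rpo) (Z :: 'z rpo) d e f p q s.
            schreier X X0 d e \<and> f \<in> rpo_hom Y X0 \<and> is_pullback Z Y X X0 p q f d \<and>
            s \<in> rpo_hom Y Z \<and> (\<forall>y\<in>carrier Y. p (s y) = y \<and> q (s y) = e (f y)) \<longrightarrow>
            schreier Z Y p s) \<and>
         (\<forall>(K :: 'k rpo) (A :: 'a rpo) (B :: 'b rpo) k d e
           (K' :: 'k1 rpo) (A' :: 'a1 rpo) (B' :: 'b1 rpo) k' d' e' u w v.
            schreier_split_exact K A B k d e \<and> schreier_split_exact K' A' B' k' d' e' \<and>
            seq_hom K A B k d e K' A' B' k' d' e' u w v \<and>
            u \<in> rpo_iso K K' \<and> v \<in> rpo_iso B B' \<longrightarrow>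
            w \<in> rpo_iso A A')"
  by (intro conjI allI impI; elim conjE) (rule schreier_pullback schreier_short_five; assumption)+

end
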